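(* As $k \to \infty$ (over positive integers $k$), \[ \triangle(k) \geq (1 - o(1))\, k^{5/3}. \] That is, for every $\varepsilon > 0$ there is $k_0$ such that $\triangle(k) \geq (1-\varepsilon) k^{5/3}$ for all integers $k \geq k_0$.
   Context: For a positive integer $k$, $\triangle(k)$ denotes the maximum number of triangles in a (finite, simple) 3-partite graph $G$ with $k$ vertices in each of its three parts such that, for any two of the three parts, the bipartite subgraph of $G$ formed by the edges between these two parts contains no cycle of length four. *)

theory Defs
  imports Complex_Main
begin

definition simple_graph :: "'a set \<Rightarrow> 'a set set \<Rightarrow> bool" where
  "simple_graph V E \<longleftrightarrow>
     finite V \<and> (\<forall>e\<in>E. \<exists>u\<in>V. \<exists>v\<in>V. u \<noteq> v \<and> e = {u, v})"

definition tripartite :: "'a set \<Rightarrow> 'a set \<Rightarrow> 'a set \<Rightarrow> 'a set \<Rightarrow> 'a set set \<Rightarrow> bool" where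
  "tripartite A B C V E \<longleftrightarrow>
     simple_graph V E \<and> V = A \<union> B \<union> C \<and>
     A \<inter> B = {} \<and> A \<inter> C = {} \<and> B \<inter> C = {} \<and>
     (\<forall>e\<in>E. \<not> e \<subseteq> A \<and> \<not> e \<subseteq> B \<and> \<not> e \<subseteq> C)"

definition edges_between :: "'a set set \<Rightarrow> 'a set \<Rightarrow> 'a set \<Rightarrow> 'a set set" where
  "edges_between E A B = {e \<in> E. \<exists>a\<in>A. \<exists>b\<in>B. e = {a, b}}"

definition has_four_cycle :: "'a set set \<Rightarrow> bool" where
  "has_four_cycle F \<longleftrightarrow>
     (\<exists>a b c d. distinct [a, b, c, d] \<and>
        {a, b} \<in> F \<and> {b, c} \<in> F \<and> {c, d} \<in> F \<and> {d, a} \<in> F)"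

definition triangles :: "'a set set \<Rightarrow> 'a set set" where
  "triangles E =
     {{x, y, z} | x y z. distinct [x, y, z] \<and> {x, y} \<in> E \<and> {y, z} \<in> E \<and> {x, z} \<in> E}"

definition admissible :: "nat \<Rightarrow> 'a set \<Rightarrow> 'a set set \<Rightarrow> bool" where
  "admissible k V E \<longleftrightarrow>
     (\<exists>A B C. tripartite A B C V E \<and> card A = k \<and> card B = k \<and> card C = k \<and>
        \<not> has_four_cycle (edges_between E A B) \<and>
        \<not> has_four_cycle (edges_between E A C) \<and>
        \<not> has_four_cycle (edges_between E B C))"

text \<open>Every finite graph is isomorphic to one whose vertices are natural numbers, so taking
  the vertices from \<^typ>\<open>nat\<close> loses no generality. The set below is finite and nonempty
  (the edgeless graph is admissible), so \<^const>\<open>Max\<close> is a genuine maximum.\<close>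

definition max_triangles :: "nat \<Rightarrow> nat" where
  "max_triangles k =
     Max {card (triangles E) | (V :: nat set) E. admissible k V E}"

end

(* Let F be the field of order Q^5, Q an odd prime power. On F, the bilinear form
   B(x,u) = x u^(Q^2) + u x^(Q^2) has no zero divisors, so relations of the form
   y - v = B(x,u) + f(x) between points (x,y), (u,v) of F^2 contain no four-cycle. With
   h(x) = x x^(Q^2) + x^Q, whose polarization is B, three such relations can be chosen so that
   (x,y), (u,v), (w,z) form a triangle as soon as h(x+u+w) = 1 and v, z are the values forced by
   x, u, w, y. The polynomial h(t) - 1 is separable, and its roots all lie in F because it encodes
   the Lyness recurrence, which has period 5. This gives Q^15 (Q^2+1) triangles on parts of size
   k = Q^10, that is more than k^(17/10). As 17/10 > 5/3, no information on the distribution of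
   primes is needed: powers of 3 suffice for Q. *)

theory Submission
  imports Defs "HOL-Algebra.Algebraic_Closure_Type"
begin

section \<open>Tripartite graphs from three relations\<close>

text \<open>As \<open>A\<close> and \<open>B\<close> are disjoint, every edge has a single
  orientation from \<open>A\<close> to \<open>B\<close>. A four-cycle therefore alternates between
  the two sets, and its two pairs of opposite vertices span a 2 by 2 rectangle in \<open>P\<close>,
  which \<open>free\<close> forbids.\<close>

lemma no_four_cycle_if_relation:
  assumes F: "F \<subseteq> {{x, y} | x y. P x y}"
    and P: "\<And>x y. P x y \<Longrightarrow> x \<in> A \<and> y \<in> B"
    and disj: "A \<inter> B = {}"
    and free: "\<And>x x' y y'. P x y \<Longrightarrow> P x y' \<Longrightarrow> P x' y \<Longrightarrow> P x' y' \<Longrightarrow> x = x' \<or> y = y'"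
  shows "\<not> has_four_cycle F"
proof
  assume "has_four_cycle F"
  then obtain a b c d where d: "distinct [a, b, c, d]"
    and e: "{a, b} \<in> F" "{b, c} \<in> F" "{c, d} \<in> F" "{d, a} \<in> F"
    unfolding has_four_cycle_def by blast
  have adj: "P x y \<or> P y x" if "{x, y} \<in> F" for x y
    using subsetD[OF F that] by (auto simp: doubleton_eq_iff)
  have P': "x \<in> A" "x \<notin> B" "y \<in> B" "y \<notin> A" if "P x y" for x y
    using P[OF that] disj by auto
  show False
  proof (cases "a \<in> A")
    case True
    then have "P a b" "P a d" "P c b" "P c d"
      using adj[OF e(1)] adj[OF e(2)] adj[OF e(3)] adj[OF e(4)] P' by blast+
    then show False using free[of a b d c] d by auto
  next
    case False
    then have "P b a" "P d a" "P b c" "P d c"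
      using adj[OF e(1)] adj[OF e(2)] adj[OF e(3)] adj[OF e(4)] P' by blast+
    then show False using free[of b a c d] d by auto
  qed
qed

text \<open>\<open>Max\<close> bounds its elements only on a finite set. Finiteness comes from a
  crude count: triangles are subsets of a set of at most \<open>3 * k\<close> vertices.\<close>

lemma card_triangles_le_max_triangles:
  fixes V :: "nat set"
  assumes "admissible k V E"
  shows "card (triangles E) \<le> max_triangles k"
proof -
  have bound: "card (triangles E') \<le> 2 ^ (3 * k)" if adm: "admissible k V' E'" for V' :: "nat set" and E'
  proof -
    obtain A B C where *: "tripartite A B C V' E'" "card A = k" "card B = k" "card C = k"
      using adm unfolding admissible_def by blast
    have graph: "simple_graph V' E'" and V': "V' = A \<union> B \<union> C"
      using *(1) unfolding tripartite_def by blast+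
    have fin: "finite V'" and edge: "\<forall>e\<in>E'. \<exists>u\<in>V'. \<exists>v\<in>V'. u \<noteq> v \<and> e = {u, v}"
      using graph unfolding simple_graph_def by simp_all
    have E': "e \<subseteq> V'" if "e \<in> E'" for e
      using bspec[OF edge that] by auto
    have "card V' \<le> card (A \<union> B) + card C" unfolding V' by (rule card_Un_le)
    also have "\<dots> \<le> 3 * k" using card_Un_le[of A B] *(2-4) by simp
    finally have le: "card V' \<le> 3 * k" .
    have "triangles E' \<subseteq> Pow V'"
      unfolding triangles_def by (auto dest: E')
    then have "card (triangles E') \<le> card (Pow V')"
      using fin by (intro card_mono) auto
    also have "\<dots> = 2 ^ card V'" using fin by (simp add: card_Pow)
    also have "\<dots> \<le> 2 ^ (3 * k)" using le by (intro power_increasing) auto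
    finally show ?thesis .
  qed
  have "finite {card (triangles E) | (V :: nat set) E. admissible k V E}"
    by (rule finite_subset[of _ "{..2 ^ (3 * k)}"]) (use bound in auto)
  then show ?thesis
    unfolding max_triangles_def by (rule Max_ge) (use assms in blast)
qed

text \<open>One set \<open>W\<close> serves three times, once inside each part. Parts have exactly
  \<open>k\<close> vertices while \<open>W\<close> may be smaller; the surplus vertices stay
  isolated, so a construction of one size serves every larger \<open>k\<close>.\<close>

lemma card_triples_le_max_triangles:
  fixes W :: "'b set" and R S T :: "'b \<Rightarrow> 'b \<Rightarrow> bool"
  assumes W: "finite W" "card W \<le> k"
    and R: "\<And>a a' b b'. {a, a', b, b'} \<subseteq> W \<Longrightarrow> R a b \<Longrightarrow> R a b' \<Longrightarrow> R a' b \<Longrightarrow> R a' b' \<Longrightarrow> a = a' \<or> b = b'"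
    and S: "\<And>a a' b b'. {a, a', b, b'} \<subseteq> W \<Longrightarrow> S a b \<Longrightarrow> S a b' \<Longrightarrow> S a' b \<Longrightarrow> S a' b' \<Longrightarrow> a = a' \<or> b = b'"
    and T: "\<And>a a' b b'. {a, a', b, b'} \<subseteq> W \<Longrightarrow> T a b \<Longrightarrow> T a b' \<Longrightarrow> T a' b \<Longrightarrow> T a' b' \<Longrightarrow> a = a' \<or> b = b'"
  shows "card {(a, b, c). a \<in> W \<and> b \<in> W \<and> c \<in> W \<and> R a b \<and> S b c \<and> T a c} \<le> max_triangles k"
proof -
  obtain e where e: "bij_betw e W {0..<card W}"
    using W(1) ex_bij_betw_finite_nat by blast
  have inj: "e a = e b \<longleftrightarrow> a = b" if "a \<in> W" "b \<in> W" for a b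
    using e that by (auto simp: bij_betw_def inj_on_def)
  have lt: "e a < k" if "a \<in> W" for a
    using bij_betwE[OF e] that W(2) by fastforce
  define part where "part i = {i * k..<i * k + k}" for i :: nat
  define emb where "emb i j U x y \<longleftrightarrow> (\<exists>a\<in>W. \<exists>b\<in>W. x = i * k + e a \<and> y = j * k + e b \<and> U a b)"
    for i j :: nat and U :: "'b \<Rightarrow> 'b \<Rightarrow> bool" and x y
  define PR PS PT where "PR = emb 0 1 R" and "PS = emb 1 2 S" and "PT = emb 0 2 T"
  define A B C where "A = part 0" and "B = part 1" and "C = part 2"
  have disj: "A \<inter> B = {}" "A \<inter> C = {}" "B \<inter> C = {}"
    by (auto simp: A_def B_def C_def part_def)
  have emb_in: "x \<in> part i \<and> y \<in> part j" if "emb i j U x y" for i j U x y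
    using that lt by (auto simp: emb_def part_def)
  have PR: "x \<in> A \<and> y \<in> B" if "PR x y" for x y
    using emb_in that unfolding PR_def A_def B_def by blast
  have PS: "x \<in> B \<and> y \<in> C" if "PS x y" for x y
    using emb_in that unfolding PS_def B_def C_def by blast
  have PT: "x \<in> A \<and> y \<in> C" if "PT x y" for x y
    using emb_in that unfolding PT_def A_def C_def by blast
  have free: "x = x' \<or> y = y'"
    if U: "\<And>a a' b b'. {a, a', b, b'} \<subseteq> W \<Longrightarrow> U a b \<Longrightarrow> U a b' \<Longrightarrow> U a' b \<Longrightarrow> U a' b' \<Longrightarrow> a = a' \<or> b = b'"
      and h: "emb i j U x y" "emb i j U x y'" "emb i j U x' y" "emb i j U x' y'"
    for i j U x x' y y'
  proof -
    obtain a b where 1: "a \<in> W" "b \<in> W" "x = i * k + e a" "y = j * k + e b" "U a b"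
      using h(1) unfolding emb_def by blast
    obtain a' b' where 2: "a' \<in> W" "b' \<in> W" "x' = i * k + e a'" "y' = j * k + e b'" "U a' b'"
      using h(4) unfolding emb_def by blast
    have "U a b'" "U a' b" using h(2,3) 1 2 inj by (auto simp: emb_def)
    then show ?thesis using U[of a a' b b'] 1 2 by auto
  qed
  define E where "E = {{x, y} | x y. PR x y} \<union> {{x, y} | x y. PS x y} \<union> {{x, y} | x y. PT x y}"
  define V where "V = A \<union> B \<union> C"
  have E_cases: "\<exists>x y. e = {x, y} \<and> (PR x y \<or> PS x y \<or> PT x y)" if "e \<in> E" for e
    using that unfolding E_def by blast
  have "tripartite A B C V E"
    unfolding tripartite_def simple_graph_def
  proof (intro conjI ballI)
    show "finite V" unfolding V_def A_def B_def C_def part_def by simp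
    fix e assume "e \<in> E"
    then obtain x y where xy: "e = {x, y}" "PR x y \<or> PS x y \<or> PT x y"
      using E_cases by blast
    have in_parts: "x \<in> A \<and> y \<in> B \<or> x \<in> B \<and> y \<in> C \<or> x \<in> A \<and> y \<in> C"
      using xy(2) PR[of x y] PS[of x y] PT[of x y] by argo
    have "x \<in> V" "y \<in> V" "x \<noteq> y"
      using in_parts disj by (auto simp: V_def)
    then show "\<exists>u\<in>V. \<exists>v\<in>V. u \<noteq> v \<and> e = {u, v}"
      using xy(1) by auto
    show "\<not> e \<subseteq> A" "\<not> e \<subseteq> B" "\<not> e \<subseteq> C"
      using in_parts disj by (auto simp: xy(1))
  qed (use disj V_def in auto)
  moreover have "edges_between E A B \<subseteq> {{x, y} | x y. PR x y}"
  proof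
    fix d assume "d \<in> edges_between E A B"
    then obtain a b where ab: "d \<in> E" "a \<in> A" "b \<in> B" "d = {a, b}"
      unfolding edges_between_def by blast
    obtain x y where xy: "d = {x, y}" "PR x y \<or> PS x y \<or> PT x y"
      using E_cases[OF ab(1)] by blast
    have "\<not> PS x y" "\<not> PT x y"
      using PS[of x y] PT[of x y] ab xy(1) disj by (auto simp: doubleton_eq_iff)
    then show "d \<in> {{x, y} | x y. PR x y}" using xy by blast
  qed
  then have "\<not> has_four_cycle (edges_between E A B)"
    by (rule no_four_cycle_if_relation[OF _ PR disj(1)]) (use free[OF R] PR_def in auto)
  moreover have "edges_between E A C \<subseteq> {{x, y} | x y. PT x y}"
  proof
    fix d assume "d \<in> edges_between E A C"
    then obtain a b where ab: "d \<in> E" "a \<in> A" "b \<in> C" "d = {a, b}"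
      unfolding edges_between_def by blast
    obtain x y where xy: "d = {x, y}" "PR x y \<or> PS x y \<or> PT x y"
      using E_cases[OF ab(1)] by blast
    have "\<not> PR x y" "\<not> PS x y"
      using PR[of x y] PS[of x y] ab xy(1) disj by (auto simp: doubleton_eq_iff)
    then show "d \<in> {{x, y} | x y. PT x y}" using xy by blast
  qed
  then have "\<not> has_four_cycle (edges_between E A C)"
    by (rule no_four_cycle_if_relation[OF _ PT disj(2)]) (use free[OF T] PT_def in auto)
  moreover have "edges_between E B C \<subseteq> {{x, y} | x y. PS x y}"
  proof
    fix d assume "d \<in> edges_between E B C"
    then obtain a b where ab: "d \<in> E" "a \<in> B" "b \<in> C" "d = {a, b}"
      unfolding edges_between_def by blast
    obtain x y where xy: "d = {x, y}" "PR x y \<or> PS x y \<or> PT x y"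
      using E_cases[OF ab(1)] by blast
    have "\<not> PR x y" "\<not> PT x y"
      using PR[of x y] PT[of x y] ab xy(1) disj by (auto simp: doubleton_eq_iff)
    then show "d \<in> {{x, y} | x y. PS x y}" using xy by blast
  qed
  then have "\<not> has_four_cycle (edges_between E B C)"
    by (rule no_four_cycle_if_relation[OF _ PS disj(3)]) (use free[OF S] PS_def in auto)
  moreover have "card A = k" "card B = k" "card C = k"
    by (simp_all add: A_def B_def C_def part_def)
  ultimately have adm: "admissible k V E"
    unfolding admissible_def by blast
  let ?N = "{(a, b, c). a \<in> W \<and> b \<in> W \<and> c \<in> W \<and> R a b \<and> S b c \<and> T a c}"
  let ?f = "\<lambda>(a, b, c). {e a, k + e b, 2 * k + e c}"
  \<comment> \<open>A triangle is an unordered set, but it meets each part in one vertex, so the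
    triple can be read off from it; this makes \<open>?f\<close> injective.\<close>
  have parts: "A \<inter> ?f (a, b, c) = {e a}" "B \<inter> ?f (a, b, c) = {k + e b}" "C \<inter> ?f (a, b, c) = {2 * k + e c}"
    if "a \<in> W" "b \<in> W" "c \<in> W" for a b c
    using lt[OF that(1)] lt[OF that(2)] lt[OF that(3)] by (auto simp: A_def B_def C_def part_def)
  have inj_f: "inj_on ?f ?N"
  proof (rule inj_onI)
    fix p q assume pq: "p \<in> ?N" "q \<in> ?N" "?f p = ?f q"
    obtain a b c a' b' c' where p: "p = (a, b, c)" and q: "q = (a', b', c')"
      by (metis prod_cases3)
    have X': "a \<in> W" "b \<in> W" "c \<in> W" "a' \<in> W" "b' \<in> W" "c' \<in> W"
      using pq p q by auto
    have eq: "?f (a, b, c) = ?f (a', b', c')" using pq(3) p q by simp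
    have "e a = e a'" "k + e b = k + e b'" "2 * k + e c = 2 * k + e c'"
      using parts[OF X'(1-3)] parts[OF X'(4-6)] unfolding eq by (metis singleton_inject)+
    then show "p = q" using X' inj p q by simp
  qed
  have "?f ` ?N \<subseteq> triangles E"
  proof
    fix d assume "d \<in> ?f ` ?N"
    then obtain a b c where abc: "a \<in> W" "b \<in> W" "c \<in> W" "R a b" "S b c" "T a c"
      "d = {e a, k + e b, 2 * k + e c}" by auto
    have "PR (e a) (k + e b)" "PS (k + e b) (2 * k + e c)" "PT (e a) (2 * k + e c)"
      unfolding PR_def PS_def PT_def emb_def using abc by auto
    then have "{e a, k + e b} \<in> E" "{k + e b, 2 * k + e c} \<in> E" "{e a, 2 * k + e c} \<in> E"
      unfolding E_def by blast+
    moreover have "distinct [e a, k + e b, 2 * k + e c]"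
      using lt[OF abc(1)] lt[OF abc(2)] by auto
    ultimately show "d \<in> triangles E"
      unfolding triangles_def abc(7) by blast
  qed
  moreover have "finite (triangles E)"
  proof (rule finite_subset)
    show "triangles E \<subseteq> Pow V"
    proof
      fix d assume "d \<in> triangles E"
      then obtain x y z where d: "d = {x, y, z}" "{x, y} \<in> E" "{x, z} \<in> E"
        unfolding triangles_def by blast
      have "e \<subseteq> V" if "e \<in> E" for e
        using E_cases[OF that] PR PS PT by (auto simp: V_def)
      then show "d \<in> Pow V" using d by auto
    qed
    show "finite (Pow V)" unfolding V_def A_def B_def C_def part_def by simp
  qed
  ultimately have "card ?N \<le> card (triangles E)"
    using card_inj_on_le[OF inj_f] by blast
  also have "\<dots> \<le> max_triangles k"
    by (rule card_triangles_le_max_triangles[OF adm])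
  finally show ?thesis .
qed

section \<open>The field of order \<open>Q^5\<close> and the pentagon equation\<close>

text \<open>Split off a linear factor, p = (X - a) q. Then p'(a) = q(a), so a is not a root of q,
  and p'(x) = (x - a) q'(x) at every root x of q, so q inherits the hypothesis.\<close>

lemma card_roots_eq_degree:
  fixes p :: "'a :: alg_closed_field poly"
  assumes "p \<noteq> 0" "\<And>x. poly p x = 0 \<Longrightarrow> poly (pderiv p) x \<noteq> 0"
  shows "card {x. poly p x = 0} = degree p"
  using assms
proof (induction "degree p" arbitrary: p)
  case 0
  then obtain c where "p = [:c:]" by (metis degree_eq_zeroE)
  then show ?case using 0 by auto
next
  case (Suc n)
  then obtain a where a: "poly p a = 0"
    using alg_closed_imp_poly_has_root[of p] by auto
  then obtain q where q: "p = [:-a, 1:] * q"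
    by (auto simp: poly_eq_0_iff_dvd)
  have q0: "q \<noteq> 0" using Suc.prems q by auto
  have deg: "degree p = Suc (degree q)"
    unfolding q using q0 by (subst degree_mult_eq) auto
  have pd: "pderiv p = q + [:-a, 1:] * pderiv q"
    unfolding q pderiv_mult by (simp add: pderiv_pCons algebra_simps)
  have qa: "poly q a \<noteq> 0" using Suc.prems(2)[OF a] by (simp add: pd)
  have "poly (pderiv q) x \<noteq> 0" if "poly q x = 0" for x
    using Suc.prems(2)[of x] that by (simp add: q[symmetric] pd) (simp add: q that)
  then have "card {x. poly q x = 0} = degree q"
    using Suc.hyps deg q0 by auto
  moreover have "{x. poly p x = 0} = insert a {x. poly q x = 0}"
    unfolding q by auto
  moreover have "finite {x. poly q x = 0}" using poly_roots_finite[OF q0] .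
  ultimately show ?case using qa deg by simp
qed

text \<open>The ambient field is algebraically closed so that separable polynomials have as many
  roots as their degree; x -> x^Q is a power of its Frobenius map.\<close>

locale odd_char_power =
  fixes Q m :: nat and type :: "'a :: alg_closed_field itself"
  assumes prime_char: "prime CHAR('a)" and odd_char: "odd CHAR('a)"
    and Q_def: "Q = CHAR('a) ^ m" and m_pos: "m > 0"
begin

lemma Q_gt_1: "Q > 1"
  using prime_gt_1_nat[OF prime_char] m_pos unfolding Q_def by (rule one_less_power)

lemma odd_Q: "odd Q"
  using odd_char unfolding Q_def by simp

lemma of_nat_Q: "of_nat Q = (0 :: 'a)"
  using m_pos by (simp add: Q_def of_nat_power)

lemma add_power_Q: "(x + y :: 'a) ^ Q ^ i = x ^ Q ^ i + y ^ Q ^ i"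
  by (rule freshmans_dream'[OF prime_char, of _ "m * i"]) (simp add: Q_def power_mult)

lemma minus_power_Q: "(- x :: 'a) ^ Q ^ i = - (x ^ Q ^ i)"
  using odd_Q by (simp add: power_minus_odd)

lemma diff_power_Q: "(x - y :: 'a) ^ Q ^ i = x ^ Q ^ i - y ^ Q ^ i"
  using add_power_Q[of x "- y"] by (simp add: minus_power_Q)

lemma power_Q_power_Q: "((x :: 'a) ^ Q ^ i) ^ Q ^ j = x ^ Q ^ (i + j)"
  by (simp add: power_add power_mult)

text \<open>The subfield of order Q^5, realised as the fixed points of the fifth iterate of x ->
  x^Q.\<close>

definition F :: "'a set" where "F = {x. x ^ Q ^ 5 = x}"

text \<open>X^(Q^5) - X is separable, because its derivative is the constant -1.\<close>

lemma card_F: "card F = Q ^ 5"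
proof -
  let ?p = "monom 1 (Q ^ 5) + (- monom 1 1) :: 'a poly"
  have gt: "Q ^ 5 > 1" using Q_gt_1 by (rule one_less_power) simp
  have deg: "degree ?p = Q ^ 5"
    using gt by (subst degree_add_eq_left) (simp_all add: degree_monom_eq)
  have "poly (pderiv ?p) x = - 1" for x
    by (simp add: pderiv_add pderiv_minus pderiv_monom poly_monom of_nat_Q del: add_uminus_conv_diff)
  moreover have "?p \<noteq> 0" using deg gt by (metis degree_0 not_less_zero)
  ultimately have "card {x. poly ?p x = 0} = degree ?p"
    by (intro card_roots_eq_degree) simp_all
  moreover have "{x. poly ?p x = 0} = F"
    by (auto simp: F_def poly_monom)
  ultimately show ?thesis by (simp only: deg)
qed

lemma finite_F: "finite F"
  using card_F Q_gt_1 by (intro card_ge_0_finite) simp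

lemma F_add: "x \<in> F \<Longrightarrow> y \<in> F \<Longrightarrow> x + y \<in> F"
  by (simp add: F_def add_power_Q)

lemma F_diff: "x \<in> F \<Longrightarrow> y \<in> F \<Longrightarrow> x - y \<in> F"
  by (simp add: F_def diff_power_Q)

lemma F_mult: "x \<in> F \<Longrightarrow> y \<in> F \<Longrightarrow> x * y \<in> F"
  by (simp add: F_def power_mult_distrib)

lemma F_power: "x \<in> F \<Longrightarrow> x ^ n \<in> F"
  unfolding F_def by (induction n) (simp_all add: power_mult_distrib)

definition pentagon :: "'a set" where "pentagon = {t. t * t ^ Q ^ 2 + t ^ Q = 1}"

text \<open>The derivative of X^(Q^2+1) + X^Q - 1 is X^(Q^2), which vanishes only at 0, and 0 is not
  a root.\<close>

lemma card_pentagon: "card pentagon = Q ^ 2 + 1"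
proof -
  let ?p = "monom 1 (Q ^ 2 + 1) + (monom 1 Q - 1) :: 'a poly"
  have gt: "Q < Q ^ 2 + 1" using Q_gt_1 by (simp add: power2_eq_square less_Suc_eq_le)
  have low: "degree (monom 1 Q - 1 :: 'a poly) \<le> Q"
    by (intro degree_diff_le) (simp_all add: degree_monom_le)
  have deg: "degree ?p = Q ^ 2 + 1"
    using gt low by (subst degree_add_eq_left) (simp_all add: degree_monom_eq)
  have pd: "poly (pderiv ?p) x = x ^ Q ^ 2" for x
    by (simp add: pderiv_add pderiv_diff pderiv_monom poly_monom of_nat_Q)
  have p: "poly ?p x = x * x ^ Q ^ 2 + x ^ Q - 1" for x
    by (simp add: poly_monom)
  have "poly ?p 0 \<noteq> 0"
    unfolding p using Q_gt_1 by (simp add: power_0_left)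
  moreover from this have "?p \<noteq> 0" by (metis poly_0)
  ultimately have "card {x. poly ?p x = 0} = degree ?p"
    by (intro card_roots_eq_degree) (auto simp only: pd power_eq_0_iff)
  moreover have "{x. poly ?p x = 0} = pentagon"
    unfolding p pentagon_def by auto
  ultimately show ?thesis by (simp only: deg)
qed

text \<open>Writing \<open>t\<^sub>i\<close> for the conjugates \<open>t ^ Q ^ i\<close>, the pentagon equation becomes the Lyness
  recurrence \<open>t\<^sub>i * t\<^sub>i\<^sub>+\<^sub>2 = 1 - t\<^sub>i\<^sub>+\<^sub>1\<close>, all of whose solutions have period 5.\<close>

lemma pentagon_subset_F: "pentagon \<subseteq> F"
proof
  fix t assume t: "t \<in> pentagon"
  define s where "s i = t ^ Q ^ i" for i
  have rec0: "s 0 * s 2 + s 1 = 1" using t by (simp add: pentagon_def s_def)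
  have rec: "s i * s (i + 2) + s (i + 1) = 1" for i
  proof -
    \<comment> \<open>Raising to the power \<open>Q ^ i\<close> is a ring homomorphism that shifts
      the indices of \<open>s\<close> by \<open>i\<close>.\<close>
    have "(s 0 * s 2 + s 1) ^ Q ^ i = 1" using rec0 by simp
    then show ?thesis
      unfolding add_power_Q power_mult_distrib s_def power_Q_power_Q
      by (simp only: add.commute add_0)
  qed
  have "t \<noteq> 0" using t Q_gt_1 by (auto simp: pentagon_def power_0_left)
  then have nz: "s i \<noteq> 0" for i by (simp add: s_def)
  have r: "s 0 * s 2 = 1 - s 1" "s 1 * s 3 = 1 - s 2" "s 2 * s 4 = 1 - s 3" "s 3 * s 5 = 1 - s 4"
    using rec[of 0] rec[of 1] rec[of 2] rec[of 3] by (simp_all add: algebra_simps numeral_eq_Suc)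
  \<comment> \<open>The target \<open>s 1 * s 4 = 1 - s 0\<close> is what the recurrence at index 4
    becomes once indices are read modulo 5.\<close>
  have "s 2 * (s 1 * s 4) = s 1 * (s 2 * s 4)" by (rule mult.left_commute)
  also have "\<dots> = s 1 - s 1 * s 3" by (simp only: r(3) right_diff_distrib mult_1_right)
  also have "\<dots> = s 2 - s 0 * s 2" by (simp only: r(1,2)) simp
  finally have "s 2 * (s 1 * s 4) = s 2 * (1 - s 0)" by (simp add: algebra_simps)
  then have 4: "s 1 * s 4 = 1 - s 0" using nz by simp
  \<comment> \<open>Evaluating this product shows that \<open>s 5\<close> and \<open>s 0\<close>
    have the same multiple by \<open>s 1 * s 3\<close>, which is nonzero.\<close>
  have "s 1 * (s 3 * s 5) = s 1 - s 1 * s 4" by (simp only: r(4) right_diff_distrib mult_1_right)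
  also have "\<dots> = s 0 - s 0 * s 2" by (simp only: r(1) 4) simp
  also have "\<dots> = s 0 * (s 1 * s 3)" by (simp only: r(2) right_diff_distrib mult_1_right)
  finally have "s 1 * (s 3 * s 5) = s 1 * (s 3 * s 0)" by (simp only: ac_simps)
  then have "s 5 = s 0" using nz by simp
  then show "t \<in> F" by (simp add: F_def s_def)
qed

section \<open>Counting triangles\<close>

definition B :: "'a \<Rightarrow> 'a \<Rightarrow> 'a" where "B x u = x * u ^ Q ^ 2 + u * x ^ Q ^ 2"

text \<open>The term \<open>x ^ Q\<close> is additive, so it does not affect the polarization; it
  turns \<open>h t = 1\<close> into the pentagon equation, whose solutions all lie in
  \<open>F\<close>.\<close>

definition h :: "'a \<Rightarrow> 'a" where "h x = x * x ^ Q ^ 2 + x ^ Q"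

lemma B_commute: "B x u = B u x"
  by (simp add: B_def)

lemma B_diff_left: "B (x - x') u = B x u - B x' u"
  by (simp add: B_def diff_power_Q algebra_simps)

lemma B_diff_right: "B x (u - u') = B x u - B x u'"
  by (metis B_commute B_diff_left)

lemma h_add: "h (x + u) = h x + h u + B x u"
  using add_power_Q[of x u 1] by (simp add: h_def B_def add_power_Q algebra_simps)

lemma B_add_left: "B (x + x') u = B x u + B x' u"
  by (simp add: B_def add_power_Q algebra_simps)

text \<open>For nonzero x and u the ratio r = u / x satisfies r^(Q^2) = -r, hence r^(Q^4) = r, and
  r^(Q^5) = r. Splitting the exponent 10 as 4 + 4 + 2 and as 5 + 5 gives -r = r, impossible in odd
  characteristic.\<close>

lemma B_eq_0:
  assumes "x \<in> F" "u \<in> F" "B x u = 0"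
  shows "x = 0 \<or> u = 0"
proof (rule ccontr)
  assume nz: "\<not> (x = 0 \<or> u = 0)"
  define r where "r = u / x"
  have r0: "r \<noteq> 0" using nz by (simp add: r_def)
  have r5: "r ^ Q ^ 5 = r" using assms by (simp add: r_def F_def power_divide)
  have r2: "r ^ Q ^ 2 = - r"
    using assms(3) nz by (simp add: r_def B_def power_divide field_simps add_eq_0_iff)
  have "r ^ Q ^ 4 = (r ^ Q ^ 2) ^ Q ^ 2" unfolding power_Q_power_Q by simp
  then have r4: "r ^ Q ^ 4 = r" by (simp add: r2 minus_power_Q)
  have "r ^ Q ^ 10 = (((r ^ Q ^ 4) ^ Q ^ 4) ^ Q ^ 2)" unfolding power_Q_power_Q by simp
  then have "r ^ Q ^ 10 = - r" by (simp add: r4 r2)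
  moreover have "r ^ Q ^ 10 = (r ^ Q ^ 5) ^ Q ^ 5" unfolding power_Q_power_Q by simp
  then have "r ^ Q ^ 10 = r" by (simp add: r5)
  ultimately have "2 * r = 0" by (metis add.right_inverse mult_2)
  then have "of_nat 2 = (0 :: 'a)" using r0 by simp
  then have "CHAR('a) dvd 2" by (simp only: of_nat_eq_0_iff_char_dvd)
  then have "CHAR('a) = 2"
    using prime_char two_is_prime_nat primes_dvd_imp_eq by blast
  then show False using odd_char by simp
qed

text \<open>In the alternating sum of the four equations the terms in y, v and f cancel, leaving
  \<open>B (x - x') (u - u') = 0\<close>. Once one pair of first coordinates agrees, the equations
  force the second coordinates to agree.\<close>

lemma four_cycle_free:
  assumes "x \<in> F" "x' \<in> F" "u \<in> F" "u' \<in> F"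
    and "y - v = B x u + f x" "y - v' = B x u' + f x" "y' - v = B x' u + f x'" "y' - v' = B x' u' + f x'"
  shows "(x, y) = (x', y') \<or> (u, v) = (u', v')"
proof -
  have "B (x - x') (u - u') = (B x u + f x) - (B x u' + f x) - (B x' u + f x') + (B x' u' + f x')"
    by (simp add: B_diff_left B_diff_right)
  also have "\<dots> = 0" unfolding assms(5-8)[symmetric] by simp
  finally have "x = x' \<or> u = u'" using B_eq_0[of "x - x'" "u - u'"] assms(1-4) F_diff by auto
  then show ?thesis
  proof
    assume "x = x'"
    then have "y - v = y' - v" using assms(5,7) by simp
    then show ?thesis using \<open>x = x'\<close> by simp
  next
    assume "u = u'"
    then have "y - v = y - v'" using assms(5,6) by simp
    then show ?thesis using \<open>u = u'\<close> by simp
  qed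
qed

lemma max_triangles_ge:
  assumes "Q ^ 10 \<le> k"
  shows "Q ^ 17 \<le> max_triangles k"
proof -
  let ?X = "F \<times> F"
  \<comment> \<open>Around a triangle the left sides y - v, v - z and z - y add up to 0, while the
    right sides add up to \<open>h (x + u + w) - 1\<close>. The constant 1 is put into
    \<open>T\<close> alone.\<close>
  define R where "R = (\<lambda>(x, y) (u, v). y - v = B x u + h x)"
  define S where "S = (\<lambda>(u, v) (w, z). v - z = B u w + h u)"
  define T where "T = (\<lambda>(x, y) (w, z). z - y = B w x + (h w - 1))"
  let ?N = "{(a, b, c). a \<in> ?X \<and> b \<in> ?X \<and> c \<in> ?X \<and> R a b \<and> S b c \<and> T a c}"
  have cX: "card ?X = Q ^ 10" by (simp add: card_cartesian_product card_F flip: power_add)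
  have finX: "finite ?X" using finite_F by simp
  have N: "card ?N \<le> max_triangles k"
  proof (rule card_triples_le_max_triangles)
    show "finite ?X" by (rule finX)
    show "card ?X \<le> k" using cX assms by simp
  next
    fix a a' b b' assume *: "{a, a', b, b'} \<subseteq> ?X" "R a b" "R a b'" "R a' b" "R a' b'"
    obtain x y x' y' u v u' v' where eq: "a = (x, y)" "a' = (x', y')" "b = (u, v)" "b' = (u', v')"
      by (metis surj_pair)
    show "a = a' \<or> b = b'"
      using four_cycle_free[of x x' u u' y v h v' y'] * unfolding eq R_def by simp
  next
    fix a a' b b' assume *: "{a, a', b, b'} \<subseteq> ?X" "S a b" "S a b'" "S a' b" "S a' b'"
    obtain x y x' y' u v u' v' where eq: "a = (x, y)" "a' = (x', y')" "b = (u, v)" "b' = (u', v')"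
      by (metis surj_pair)
    show "a = a' \<or> b = b'"
      using four_cycle_free[of x x' u u' y v h v' y'] * unfolding eq S_def by simp
  next
    fix a a' b b' assume *: "{a, a', b, b'} \<subseteq> ?X" "T a b" "T a b'" "T a' b" "T a' b'"
    obtain x y x' y' u v u' v' where eq: "a = (x, y)" "a' = (x', y')" "b = (u, v)" "b' = (u', v')"
      by (metis surj_pair)
    show "a = a' \<or> b = b'"
      \<comment> \<open>In \<open>T\<close> the second point plays the first role, since the extra
        term depends on w.\<close>
      using four_cycle_free[of u u' x x' v y "\<lambda>w. h w - 1" y' v'] * unfolding eq T_def by auto
  qed
  define v where "v x u y = y - B x u - h x" for x u y
  \<comment> \<open>The free parameters are x, u, y and the sum t = x + u + w. \<open>R\<close> and
    \<open>S\<close> have the same shape, so \<open>v\<close> gives both remaining second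
    coordinates; t is recovered from w, x and u.\<close>
  define g where "g = (\<lambda>(x, u, y, t). ((x, y), (u, v x u y), (t - x - u, v u (t - x - u) (v x u y))))"
  let ?P = "F \<times> F \<times> F \<times> pentagon"
  have "inj_on g ?P"
    by (auto simp: inj_on_def g_def)
  moreover have "g ` ?P \<subseteq> ?N"
  proof
    fix d assume "d \<in> g ` ?P"
    then obtain x u y t where *: "x \<in> F" "u \<in> F" "y \<in> F" "t \<in> pentagon" and d: "d = g (x, u, y, t)"
      by auto
    define w where "w = t - x - u"
    have tF: "t \<in> F" using *(4) pentagon_subset_F by blast
    have wF: "w \<in> F" using * tF unfolding w_def by (intro F_diff)
    have hF: "h a \<in> F" if "a \<in> F" for a
      using that unfolding h_def by (intro F_add F_mult F_power)
    have BF: "B a b \<in> F" if "a \<in> F" "b \<in> F" for a b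
      using that unfolding B_def by (intro F_add F_mult F_power)
    have vF: "v a b c \<in> F" if "a \<in> F" "b \<in> F" "c \<in> F" for a b c
      using that unfolding v_def by (intro F_diff hF BF)
    have "x + u + w = t" by (simp add: w_def)
    then have "h (x + u + w) = 1" using *(4) by (simp add: pentagon_def h_def)
    then have sum: "h x + h u + h w + B x u + B u w + B w x = 1"
      unfolding h_add B_add_left B_commute[of w x] by (simp only: ac_simps)
    have "T (x, y) (w, v u w (v x u y))"
      using sum unfolding T_def v_def by (simp add: algebra_simps)
    moreover have "R (x, y) (u, v x u y)" "S (u, v x u y) (w, v u w (v x u y))"
      by (simp_all add: R_def S_def v_def)
    moreover have "d = ((x, y), (u, v x u y), (w, v u w (v x u y)))"
      by (simp add: d g_def w_def)
    ultimately show "d \<in> ?N" using * wF vF by simp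
  qed
  moreover have "finite ?N"
    by (rule finite_subset[of _ "?X \<times> ?X \<times> ?X"]) (use finX in auto)
  ultimately have "card ?P \<le> card ?N" by (rule card_inj_on_le)
  moreover have "card ?P = Q ^ 5 * (Q ^ 5 * (Q ^ 5 * (Q ^ 2 + 1)))"
    by (simp only: card_cartesian_product card_F card_pentagon)
  moreover have "Q ^ 17 \<le> Q ^ 5 * (Q ^ 5 * (Q ^ 5 * (Q ^ 2 + 1)))"
    by (simp add: algebra_simps flip: power_add)
  ultimately show ?thesis using N by linarith
qed

end

section \<open>A field of characteristic 3\<close>

text \<open>A concrete field of characteristic 3, whose algebraic closure is the ambient field of
  the construction.\<close>

datatype gf3 = Zero3 | One3 | Two3

instantiation gf3 :: field
begin

fun plus_gf3 where
  "Zero3 + y = (y :: gf3)"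
| "x + Zero3 = (x :: gf3)"
| "One3 + One3 = Two3"
| "Two3 + Two3 = One3"
| "One3 + Two3 = Zero3"
| "Two3 + One3 = Zero3"

fun times_gf3 where
  "Zero3 * y = (Zero3 :: gf3)"
| "One3 * y = (y :: gf3)"
| "Two3 * Zero3 = Zero3"
| "Two3 * One3 = Two3"
| "Two3 * Two3 = One3"

fun uminus_gf3 where
  "- Zero3 = Zero3"
| "- One3 = Two3"
| "- Two3 = One3"

definition "(0 :: gf3) = Zero3"
definition "(1 :: gf3) = One3"
definition "x - y = x + (- y :: gf3)"
text \<open>Both nonzero elements square to 1, and 0 is its own inverse by convention.\<close>

definition "inverse x = (x :: gf3)"
definition "x div y = x * (y :: gf3)"

instance
proof
  fix a b c :: gf3
  show "a + b + c = a + (b + c)" "a + b = b + a" "a * b * c = a * (b * c)" "a * b = b * a"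
    "(a + b) * c = a * c + b * c"
    by (cases a; cases b; cases c; simp)+
  show "0 + a = a" "1 * a = a" "- a + a = 0" "a \<noteq> 0 \<Longrightarrow> inverse a * a = 1"
    "(0 :: gf3) \<noteq> 1" "inverse (0 :: gf3) = 0"
    by (cases a; simp add: zero_gf3_def one_gf3_def inverse_gf3_def)+
qed (simp_all add: minus_gf3_def inverse_gf3_def divide_gf3_def)

end

lemma CHAR_gf3: "CHAR(gf3) = 3"
proof -
  have "of_nat 3 = (0 :: gf3)"
    by (simp add: numeral_3_eq_3 zero_gf3_def one_gf3_def)
  then have "CHAR(gf3) dvd 3" by (simp only: of_nat_eq_0_iff_char_dvd)
  moreover have "prime (3 :: nat)" by simp
  ultimately have "CHAR(gf3) = 1 \<or> CHAR(gf3) = 3" using prime_nat_iff by blast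
  then show ?thesis by simp
qed

section \<open>Powers of 3 and the passage to all large k\<close>

lemma max_triangles_ge_power_3:
  assumes "m > 0" "(3 ^ m) ^ 10 \<le> k"
  shows "(3 ^ m) ^ 17 \<le> max_triangles k"
proof -
  interpret odd_char_power "3 ^ m" m "TYPE(gf3 alg_closure)"
    by unfold_locales (simp_all add: CHAR_gf3 assms)
  show ?thesis using assms by (intro max_triangles_ge)
qed

text \<open>Since the exponent \<open>17 / 10\<close> exceeds \<open>5 / 3\<close>, the constant factor lost by rounding \<open>k\<close>
  down to a tenth power of a power of 3 is harmless.\<close>

lemma powr_le_max_triangles:
  assumes "k \<ge> (3 :: nat) ^ 510"
  shows "real k powr (5 / 3) \<le> real (max_triangles k)"
proof -
  \<comment> \<open>With Q = 3^m the part size Q^10 is \<open>b ^ m\<close>, so m is chosen with k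
    between consecutive powers of \<open>b\<close>.\<close>
  define b :: nat where "b = 3 ^ 10"
  have k: "b ^ 51 \<le> k" using assms by (simp add: b_def flip: power_mult)
  have b1: "1 < b" by (simp add: b_def)
  have "k \<ge> 1" using k b1 by (metis One_nat_def Suc_leI gr0I le_zero_eq not_one_less_zero power_not_zero)
  then obtain m where m: "b ^ m \<le> k" "k < b ^ (m + 1)"
    using ex_power_ivl1[of b k] b1 by auto
  have "b ^ 51 < b ^ (m + 1)" using k m(2) by (rule le_less_trans)
  then have "51 < m + 1" by (rule power_less_imp_less_exp[OF b1])
  then have m51: "51 \<le> m" by simp
  have "real k \<le> real (b ^ (m + 1))" using m(2) by linarith
  also have "\<dots> = 3 powr real (10 * (m + 1))"
    unfolding b_def power_mult[symmetric] of_nat_power of_nat_numeral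
    by (rule powr_realpow[symmetric]) simp
  finally have "real k powr (5 / 3) \<le> (3 powr real (10 * (m + 1))) powr (5 / 3)"
    by (intro powr_mono2) auto
  \<comment> \<open>The exponents compare as 50 (m + 1) \<le> 51 m, which holds from m = 50 on; the
    threshold 3^510 = b^51 ensures m \<ge> 51.\<close>
  also have "\<dots> \<le> 3 powr (17 * m)"
    using m51 by (simp add: powr_powr)
  also have "\<dots> = real ((3 ^ m) ^ 17)"
    by (simp add: powr_realpow[symmetric] powr_powr mult.commute flip: power_mult)
  also have "\<dots> \<le> real (max_triangles k)"
  proof -
    have "(3 ^ m) ^ 10 \<le> k"
      using m(1) unfolding b_def by (metis mult.commute power_mult)
    then have "(3 ^ m) ^ 17 \<le> max_triangles k"
      using m51 by (intro max_triangles_ge_power_3) simp_all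
    then show ?thesis by (simp only: of_nat_le_iff)
  qed
  finally show ?thesis .
qed

theorem mainTheorem2:
  shows "\<forall>\<epsilon>::real. \<epsilon> > 0 \<longrightarrow>
    (\<exists>k0::nat. k0 > 0 \<and>
      (\<forall>k::nat. k \<ge> k0 \<longrightarrow> real (max_triangles k) \<ge> (1 - \<epsilon>) * real k powr (5 / 3)))"
proof (intro allI impI)
  fix \<epsilon> :: real assume \<epsilon>: "\<epsilon> > 0"
  \<comment> \<open>The threshold is the same for every \<epsilon>, because the bound already holds
    with constant 1.\<close>
  define k0 :: nat where "k0 = 3 ^ 510"
  have "k0 > 0" unfolding k0_def by (rule zero_less_power) simp
  moreover have "(1 - \<epsilon>) * real k powr (5 / 3) \<le> real (max_triangles k)" if "k0 \<le> k" for k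
  proof -
    have "(1 - \<epsilon>) * real k powr (5 / 3) \<le> 1 * real k powr (5 / 3)"
      using \<epsilon> by (intro mult_right_mono) auto
    also have "\<dots> = real k powr (5 / 3)" by (rule mult_1)
    also have "\<dots> \<le> real (max_triangles k)"
      using that unfolding k0_def by (rule powr_le_max_triangles)
    finally show ?thesis .
  qed
  ultimately show "\<exists>k0::nat. k0 > 0 \<and>
      (\<forall>k::nat. k \<ge> k0 \<longrightarrow> real (max_triangles k) \<ge> (1 - \<epsilon>) * real k powr (5 / 3))"
    by blast
qed

end
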